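(* Assume the standing assumption and the strong pseudomonotonicity assumption stated in the context. Then for any fixed $t\in[0,T]$ and $x\in H$ there exists a unique $u\in H$, denoted $u_x(t)$, such that $$Pu\in K(t)\quad\text{and}\quad \langle h(t,x,u)-u,\;v-Pu\rangle\le 0\quad\text{for all } v\in K(t).$$
   Context: Let $H$ be a separable real Hilbert space with inner product $\langle\cdot,\cdot\rangle$ and norm $\|\cdot\|$, and let $T>0$. A mapping $G:[0,T]\times X\to H$ ($X$ a separable metric space) is Carathéodory if $t\mapsto G(t,z)$ is strongly measurable for every $z\in X$, and $z\mapsto G(t,z)$ is continuous for almost every $t\in[0,T]$. Standing assumption: (i) $A:D(A)\subset H\to H$ is the infinitesimal generator of a strongly continuous semigroup $\{e^{At}\}_{t\ge0}$ on $H$; (ii) $P:H\to H$ is linear, bounded, self-adjoint and coercive (so $P$ is invertible with bounded inverse and $P^{-1}$ is strongly monotone); (iii) $K:[0,T]\rightrightarrows H$ is a set-valued mapping with nonempty, closed, convex values; (iv) $f,h:[0,T]\times H\times H\to H$ are Carathéodory mappings (with $X=H\times H$), and $t\mapsto f(t,0,0)$ belongs to $L^1(0,T;H)$. For $t\in[0,T]$, $x\in H$ define $F_{t,x}:H\to H$ by $F_{t,x}(y):=P^{-1}y-h(t,x,P^{-1}y)$. An operator $F:H\to H$ is strongly pseudomonotone on $C\subset H$ with modulus $m>0$ if for all $y,z\in C$: $\langle F(y),z-y\rangle\ge0$ implies $\langle F(z),z-y\rangle\ge m\|z-y\|^2$. Strong pseudomonotonicity assumption: there are $\gamma>0$ and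 $L_F>0$ such that for every $t\in[0,T]$ and every $x\in H$, the operator $F_{t,x}$ is strongly pseudomonotone on $K(t)$ with modulus $\gamma$ and Lipschitz continuous on $H$ with modulus $L_F$. *)

theory Defs
  imports "HOL-Analysis.Analysis"
begin

text \<open>
  A separable real Hilbert space is a type of sort
  \<open>{real_inner, banach, second_countable_topology}\<close>: on metric spaces second countability is
  the same as separability.  Functions of time are total functions on the reals of which only
  the values on \<open>{0..T}\<close> (for semigroups: on \<open>{0..}\<close>) are constrained.
\<close>

definition strongly_measurable :: "'a measure \<Rightarrow> ('a \<Rightarrow> 'b::topological_space) \<Rightarrow> bool" where
  "strongly_measurable M g \<longleftrightarrow>
     (\<exists>s. (\<forall>n::nat. simple_function M (s n)) \<and> (AE t in M. (\<lambda>n. s n t) \<longlonglongrightarrow> g t))"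

definition caratheodory ::
  "real \<Rightarrow> (real \<Rightarrow> 'z::{metric_space, second_countable_topology} \<Rightarrow> 'h::real_normed_vector) \<Rightarrow> bool"
where
  "caratheodory T G \<longleftrightarrow>
     (\<forall>z. strongly_measurable (lebesgue_on {0..T}) (\<lambda>t. G t z)) \<and>
     (AE t in lebesgue_on {0..T}. continuous_on UNIV (G t))"

definition C0_semigroup :: "(real \<Rightarrow> 'h::real_normed_vector \<Rightarrow>\<^sub>L 'h) \<Rightarrow> bool" where
  "C0_semigroup S \<longleftrightarrow>
     S 0 = id_blinfun \<and>
     (\<forall>s\<ge>0. \<forall>t\<ge>0. S (s + t) = S s o\<^sub>L S t) \<and>
     (\<forall>x. ((\<lambda>t. blinfun_apply (S t) x) \<longlongrightarrow> x) (at_right 0))"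

text \<open>
  An unbounded operator is given by its domain \<open>D\<close> and a total function \<open>A\<close> that is
  meaningful on \<open>D\<close> only.  The domain of the generator is not a free choice: it consists of
  all points where the right derivative of the orbit at \<open>0\<close> exists.
\<close>

definition infinitesimal_generator ::
  "(real \<Rightarrow> 'h::real_normed_vector \<Rightarrow>\<^sub>L 'h) \<Rightarrow> 'h set \<Rightarrow> ('h \<Rightarrow> 'h) \<Rightarrow> bool"
where
  "infinitesimal_generator S D A \<longleftrightarrow>
     D = {x. \<exists>y. ((\<lambda>t. (blinfun_apply (S t) x - x) /\<^sub>R t) \<longlongrightarrow> y) (at_right 0)} \<and>
     (\<forall>x\<in>D. ((\<lambda>t. (blinfun_apply (S t) x - x) /\<^sub>R t) \<longlongrightarrow> A x) (at_right 0))"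

definition self_adjoint :: "('h::real_inner \<Rightarrow> 'h) \<Rightarrow> bool" where
  "self_adjoint P \<longleftrightarrow> (\<forall>x y. P x \<bullet> y = x \<bullet> P y)"

definition coercive :: "('h::real_inner \<Rightarrow> 'h) \<Rightarrow> bool" where
  "coercive P \<longleftrightarrow> (\<exists>c>0. \<forall>x. P x \<bullet> x \<ge> c * (norm x)\<^sup>2)"

definition strongly_pseudomonotone_on ::
  "'h::real_inner set \<Rightarrow> real \<Rightarrow> ('h \<Rightarrow> 'h) \<Rightarrow> bool"
where
  "strongly_pseudomonotone_on C m F \<longleftrightarrow>
     m > 0 \<and> (\<forall>y\<in>C. \<forall>z\<in>C. F y \<bullet> (z - y) \<ge> 0 \<longrightarrow> F z \<bullet> (z - y) \<ge> m * (norm (z - y))\<^sup>2)"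

text \<open>
  The operator \<open>F\<^bsub>t,x\<^esub>\<close>.  A bounded linear coercive \<open>P\<close> on a Hilbert space is
  bijective (Lax--Milgram), so \<open>inv P\<close> is its two-sided inverse.
\<close>

definition F_op ::
  "('h::real_inner \<Rightarrow> 'h) \<Rightarrow> (real \<Rightarrow> 'h \<Rightarrow> 'h \<Rightarrow> 'h) \<Rightarrow> real \<Rightarrow> 'h \<Rightarrow> 'h \<Rightarrow> 'h"
where
  "F_op P h t x y = inv P y - h t x (inv P y)"

end

theory Submission imports Defs begin

text \<open>
  Since \<open>P\<close> is bijective, \<open>y = P u\<close> turns the claim into unique solvability of the
  variational inequality \<open>F y \<bullet> (v - y) \<ge> 0\<close> on the closed convex set \<open>K t\<close>.  Strong
  pseudomonotonicity gives uniqueness and shows that any solution lies in all the Minty sets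
  \<open>{y. m * (norm (v - y))\<^sup>2 \<le> F v \<bullet> (v - y)}\<close>, which are closed balls because \<open>m > 0\<close>.
  These balls satisfy the KKM covering condition, and for convex sets the KKM principle needs no
  fixed point theorem: it follows from the Klee--Berge intersection theorem, proved by slicing with
  a separating hyperplane.  Completeness then passes from finite to arbitrary intersections, and
  continuity of \<open>F\<close> along segments turns a common point of the balls into a solution.
\<close>

section \<open>Intersection theorems for finitely many convex sets\<close>

text \<open>Compactness yields a closest pair \<open>a\<close>, \<open>b\<close>. Each of the two is
  the point of its set nearest to the other, so \<open>b - a\<close> is normal to supporting
  half-spaces at both, and the level halfway between them separates strictly in any
  dimension.\<close>

lemma separating_hyperplane_compact_compact:
  fixes A B :: "'a::real_inner set"
  assumes A: "convex A" "compact A" "A \<noteq> {}" and B: "convex B" "compact B" "B \<noteq> {}"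
    and disj: "A \<inter> B = {}"
  obtains w c where "\<And>x. x \<in> A \<Longrightarrow> w \<bullet> x < c" "\<And>x. x \<in> B \<Longrightarrow> w \<bullet> x > c"
proof -
  have "continuous_on (A \<times> B) (\<lambda>p. dist (fst p) (snd p))"
    by (intro continuous_intros)
  from continuous_attains_inf[OF compact_Times[OF A(2) B(2)] _ this]
  obtain a b where ab: "a \<in> A" "b \<in> B"
    and min: "\<And>x y. x \<in> A \<Longrightarrow> y \<in> B \<Longrightarrow> dist a b \<le> dist x y"
    using A(3) B(3) by fastforce
  define w where "w = b - a"
  have "w \<noteq> 0" using ab disj by (auto simp: w_def)
  hence w: "w \<bullet> w > 0" by simp
  have 1: "w \<bullet> (x - a) \<le> 0" if "x \<in> A" for x
    unfolding w_def using any_closest_point_dot[OF A(1) compact_imp_closed[OF A(2)] ab(1) that, of b]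
      min ab by (simp add: dist_commute)
  have 2: "w \<bullet> (x - b) \<ge> 0" if "x \<in> B" for x
  proof -
    have "(a - b) \<bullet> (x - b) \<le> 0"
      using any_closest_point_dot[OF B(1) compact_imp_closed[OF B(2)] ab(2) that, of a] min ab by simp
    thus ?thesis unfolding w_def by (simp add: inner_diff_left)
  qed
  have "w \<bullet> b - w \<bullet> a > 0" using w by (simp add: w_def inner_diff_right)
  show ?thesis
  proof (rule that[of w "(w \<bullet> a + w \<bullet> b) / 2"])
    show "w \<bullet> x < (w \<bullet> a + w \<bullet> b) / 2" if "x \<in> A" for x
      using 1[OF that] \<open>w \<bullet> b - w \<bullet> a > 0\<close> by (simp add: inner_diff_right)
    show "w \<bullet> x > (w \<bullet> a + w \<bullet> b) / 2" if "x \<in> B" for x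
      using 2[OF that] \<open>w \<bullet> b - w \<bullet> a > 0\<close> by (simp add: inner_diff_right)
  qed
qed

text \<open>Induction on the number of sets: if \<open>A n\<close> missed the intersection
  \<open>B\<close> of the others, the slices of the others by a separating hyperplane would again
  satisfy all hypotheses. Their common point would lie in \<open>B\<close> and on the hyperplane,
  which is impossible.\<close>

theorem Klee_Berge:
  fixes A :: "'i \<Rightarrow> 'a::real_inner set"
  assumes "finite I" "\<And>i. i \<in> I \<Longrightarrow> convex (A i)" "\<And>i. i \<in> I \<Longrightarrow> compact (A i)"
    and "convex (\<Union>i\<in>I. A i)" "(\<Union>i\<in>I. A i) \<noteq> {}"
    and "\<And>j. j \<in> I \<Longrightarrow> (\<Inter>i\<in>I - {j}. A i) \<noteq> {}"
  shows "(\<Inter>i\<in>I. A i) \<noteq> {}"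
  using assms
proof (induction I arbitrary: A rule: finite_induct)
  case empty
  then show ?case by simp
next
  case (insert n J A)
  show ?case
  proof (cases "J = {}")
    case True
    with insert.prems show ?thesis by simp
  next
    case False
    define B where "B = (\<Inter>i\<in>J. A i)"
    define U where "U = (\<Union>i\<in>insert n J. A i)"
    have U: "convex U" using insert.prems(3) unfolding U_def .
    have "convex B"
      unfolding B_def using insert.prems(1) by (auto intro!: convex_INT)
    have "compact B"
    proof -
      from False obtain j where "j \<in> J" by auto
      hence "A j \<inter> B = B" by (auto simp: B_def)
      moreover have "closed B"
        unfolding B_def using insert.prems(2) by (auto intro: compact_imp_closed)
      ultimately show ?thesis
        using compact_Int_closed[of "A j" B] insert.prems(2)[of j] \<open>j \<in> J\<close> by simp
    qed
    have "B \<noteq> {}" using insert.prems(5)[of n] \<open>n \<notin> J\<close> by (simp add: B_def)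
    show ?thesis
    proof (rule ccontr)
      assume "\<not> ?thesis"
      hence disj: "A n \<inter> B = {}" by (auto simp: B_def)
      have "A n \<noteq> {}"
      proof -
        from False obtain j where "j \<in> J" by auto
        with insert.prems(5)[of j] \<open>n \<notin> J\<close> show ?thesis by auto
      qed
      then obtain w c where wA: "\<And>x. x \<in> A n \<Longrightarrow> w \<bullet> x < c" and wB: "\<And>x. x \<in> B \<Longrightarrow> w \<bullet> x > c"
        using separating_hyperplane_compact_compact[of "A n" B] insert.prems(1,2) \<open>convex B\<close> \<open>compact B\<close> \<open>B \<noteq> {}\<close> disj
        by blast
      \<comment> \<open>The hyperplane misses \<open>A n\<close>, so the slices \<open>A i \<inter> H\<close> with \<open>i \<in> J\<close> cover \<open>U \<inter> H\<close>.\<close>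
      define H where "H = {x. w \<bullet> x = c}"
      have H: "convex H" "closed H"
        unfolding H_def by (rule convex_hyperplane, rule closed_hyperplane)
      obtain p where p: "p \<in> B" using \<open>B \<noteq> {}\<close> by auto
      \<comment> \<open>A point \<open>q\<close> of all sets but \<open>A j\<close> lies in
        \<open>A n\<close>, hence on the opposite side of \<open>H\<close> from \<open>p\<close>.
        The segment from \<open>q\<close> to \<open>p\<close> crosses \<open>H\<close> and stays in
        each \<open>A i\<close> with \<open>i\<close> in \<open>J - {j}\<close>, and in
        \<open>U\<close>, by convexity.\<close>
      have slice: "(\<Inter>i\<in>J - {j}. A i) \<inter> U \<inter> H \<noteq> {}" if "j \<in> J" for j
      proof -
        obtain q where q: "\<And>i. i \<in> insert n J - {j} \<Longrightarrow> q \<in> A i"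
          using insert.prems(5)[of j] \<open>j \<in> J\<close> by blast
        have "q \<in> A n" using q \<open>j \<in> J\<close> \<open>n \<notin> J\<close> by auto
        obtain z where z: "z \<in> closed_segment q p" "w \<bullet> z = c"
          using connected_ivt_hyperplane[OF connected_segment, of q q p p w c]
            wA[OF \<open>q \<in> A n\<close>] wB[OF p] by auto
        have "z \<in> A i" if "i \<in> J - {j}" for i
          using closed_segment_subset[of q "A i" p] q[of i] p that insert.prems(1)[of i] z
          by (auto simp: B_def)
        moreover have "z \<in> U"
          using closed_segment_subset[of q U p] \<open>q \<in> A n\<close> p that z U by (auto simp: B_def U_def)
        ultimately show ?thesis using z by (auto simp: H_def)
      qed
      have UH: "(\<Union>i\<in>J. A i \<inter> H) = U \<inter> H"
        using wA by (fastforce simp: U_def H_def)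
      have "(\<Inter>i\<in>J. A i \<inter> H) \<noteq> {}"
      proof (rule insert.IH)
        show "convex (A i \<inter> H)" "compact (A i \<inter> H)" if "i \<in> J" for i
          using insert.prems(1,2)[of i] H that by (auto intro: convex_Int)
        show "convex (\<Union>i\<in>J. A i \<inter> H)" "(\<Union>i\<in>J. A i \<inter> H) \<noteq> {}"
          unfolding UH using U H slice False by (auto intro: convex_Int)
        show "(\<Inter>i\<in>J - {j}. A i \<inter> H) \<noteq> {}" if "j \<in> J" for j
          using slice[OF that] by auto
      qed
      then obtain z where z: "\<And>i. i \<in> J \<Longrightarrow> z \<in> A i \<inter> H" by blast
      hence "z \<in> B" "z \<in> H" using False by (auto simp: B_def)
      thus False using wB[of z] by (simp add: H_def)
    qed
  qed
qed

text \<open>Trimmed to the compact set \<open>convex hull V\<close>, the sets have this hull as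
  their union, by the covering hypothesis for \<open>W = V\<close>. The induction hypothesis for
  \<open>V - {j}\<close> supplies the remaining premise of \<open>Klee_Berge\<close>.\<close>

theorem KKM_convex:
  fixes G :: "'a::real_inner \<Rightarrow> 'a set"
  assumes "finite V" "V \<noteq> {}"
    and "\<And>v. v \<in> V \<Longrightarrow> closed (G v)" "\<And>v. v \<in> V \<Longrightarrow> convex (G v)"
    and "\<And>W. W \<subseteq> V \<Longrightarrow> convex hull W \<subseteq> (\<Union>v\<in>W. G v)"
  shows "convex hull V \<inter> (\<Inter>v\<in>V. G v) \<noteq> {}"
  using assms
proof (induction V rule: finite_psubset_induct)
  case (psubset V)
  have "(\<Inter>v\<in>V. G v \<inter> convex hull V) \<noteq> {}"
  proof (rule Klee_Berge)
    show "finite V" by fact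
    show "convex (G v \<inter> convex hull V)" "compact (G v \<inter> convex hull V)" if "v \<in> V" for v
      using psubset.prems(2,3)[OF that] finite_imp_compact_convex_hull[OF psubset.hyps]
      by (auto intro: convex_Int closed_Int_compact)
    have eq: "(\<Union>v\<in>V. G v \<inter> convex hull V) = convex hull V"
      using psubset.prems(4)[of V] by auto
    show "convex (\<Union>v\<in>V. G v \<inter> convex hull V)" "(\<Union>v\<in>V. G v \<inter> convex hull V) \<noteq> {}"
      unfolding eq using psubset.prems(1) by auto
    show "(\<Inter>v\<in>V - {j}. G v \<inter> convex hull V) \<noteq> {}" if "j \<in> V" for j
    proof (cases "V - {j} = {}")
      case False
      have "convex hull (V - {j}) \<inter> (\<Inter>v\<in>V - {j}. G v) \<noteq> {}"
        using that False psubset.prems(2,3) by (intro psubset.IH psubset.prems(4)) auto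
      moreover have "convex hull (V - {j}) \<subseteq> convex hull V" by (intro hull_mono) auto
      ultimately show ?thesis by blast
    qed simp
  qed
  thus ?case using psubset.prems(1) by blast
qed

section \<open>Infinite intersections in a Hilbert space\<close>

lemma nested_convex_nonempty:
  fixes S :: "nat \<Rightarrow> 'a::{real_inner, complete_space} set"
  assumes closed: "\<And>n. closed (S n)" and convex: "\<And>n. convex (S n)"
    and nonempty: "\<And>n. S n \<noteq> {}" and dec: "decseq S" and "bounded (S 0)"
  obtains a where "\<And>n. a \<in> S n"
proof -
  \<comment> \<open>By the parallelogram law, points of \<open>S n\<close> of nearly minimal norm are close to each other.\<close>
  define d where "d n = (INF x\<in>S n. (norm x)\<^sup>2)" for n
  have bdd_below: "bdd_below ((\<lambda>x. (norm x)\<^sup>2) ` S n)" for n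
    by (rule bdd_belowI[of _ 0]) auto
  have d_le: "d n \<le> (norm x)\<^sup>2" if "x \<in> S n" for n x
    unfolding d_def by (rule cINF_lower[OF bdd_below that])
  have sub: "S n \<subseteq> S m" if "m \<le> n" for m n using dec that by (auto dest: decseqD)
  have inc: "incseq d"
    unfolding incseq_def d_def by (intro allI impI cINF_superset_mono nonempty bdd_below sub) auto
  obtain r where r: "\<And>x. x \<in> S 0 \<Longrightarrow> norm x \<le> r" using \<open>bounded (S 0)\<close> by (auto simp: bounded_iff)
  \<comment> \<open>Boundedness of \<open>S 0\<close> keeps the increasing sequence \<open>d\<close>
    of least squared norms from diverging.\<close>
  have "d n \<le> r\<^sup>2" for n
  proof -
    obtain x where "x \<in> S n" using nonempty by blast
    moreover from this have "norm x \<le> r" using r sub[of 0 n] by auto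
    ultimately show ?thesis using d_le[of x n] power_mono[of "norm x" r 2] by auto
  qed
  hence bdd_above: "bdd_above (range d)" by (intro bdd_aboveI[of _ "r\<^sup>2"]) auto
  define D where "D = (SUP n. d n)"
  have lim: "d \<longlonglongrightarrow> D" unfolding D_def by (rule LIMSEQ_incseq_SUP[OF bdd_above inc])
  have d_D: "d n \<le> D" for n unfolding D_def by (rule cSUP_upper[OF _ bdd_above]) simp
  \<comment> \<open>The slack \<open>1 / real (Suc n)\<close> keeps \<open>R n\<close> nonempty,
    since the infimum \<open>d n\<close> need not be known to be attained; it shrinks with
    \<open>n\<close>, so \<open>R\<close> stays decreasing.\<close>
  define R where "R n = S n \<inter> {x. (norm x)\<^sup>2 \<le> D + 1 / real (Suc n)}" for n
  obtain a where "\<And>n. a \<in> R n"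
  proof (rule decreasing_closed_nest[of R])
    show "closed (R n)" for n
      unfolding R_def by (intro closed_Int closed closed_Collect_le continuous_intros)
    show "R n \<noteq> {}" for n
    proof -
      have "d n < D + 1 / real (Suc n)" using d_D[of n] by (smt (verit) divide_pos_pos of_nat_0_less_iff zero_less_Suc)
      then obtain x where "x \<in> S n" "(norm x)\<^sup>2 < D + 1 / real (Suc n)"
        unfolding d_def cINF_less_iff[OF nonempty bdd_below] by auto
      thus ?thesis by (auto simp: R_def)
    qed
    show "R n \<subseteq> R m" if "m \<le> n" for m n
    proof -
      have "1 / real (Suc n) \<le> 1 / real (Suc m)" using that by (intro divide_left_mono) auto
      thus ?thesis using sub[OF that] by (auto simp: R_def)
    qed
    fix e :: real assume "e > 0"
    \<comment> \<open>This expression bounds the squared diameter of \<open>R n\<close>: the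
      parallelogram law gives at most \<open>4 * (D + 1 / real (Suc n))\<close> minus four times the
      squared norm of a midpoint, which lies in \<open>S n\<close> and so has squared norm at least
      \<open>d n\<close>.\<close>
    have "(\<lambda>n. 4 * (D - d n) + 4 * (1 / real (Suc n))) \<longlonglongrightarrow> 4 * (D - D) + 4 * 0"
      by (intro tendsto_intros lim lim_1_over_n[THEN LIMSEQ_Suc])
    hence "eventually (\<lambda>n. 4 * (D - d n) + 4 * (1 / real (Suc n)) < e\<^sup>2) sequentially"
      by (rule order_tendstoD) (use \<open>e > 0\<close> in simp)
    then obtain n where n: "4 * (D - d n) + 4 * (1 / real (Suc n)) < e\<^sup>2"
      by (auto simp: eventually_sequentially)
    have "dist x y < e" if "x \<in> R n" "y \<in> R n" for x y
    proof -
      define m where "m = (1/2) *\<^sub>R x + (1/2) *\<^sub>R y"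
      have "m \<in> S n" unfolding m_def using that by (intro convexD convex) (auto simp: R_def)
      hence "d n \<le> (norm m)\<^sup>2" by (rule d_le)
      moreover have "(dist x y)\<^sup>2 = 2 * (norm x)\<^sup>2 + 2 * (norm y)\<^sup>2 - 4 * (norm m)\<^sup>2"
        unfolding m_def dist_norm power2_norm_eq_inner
        by (simp add: inner_add inner_diff inner_commute algebra_simps)
      moreover define k where "k = 1 / real (Suc n)"
      have "(norm x)\<^sup>2 \<le> D + k" "(norm y)\<^sup>2 \<le> D + k"
        using that by (auto simp: R_def k_def)
      moreover have "4 * (D - d n) + 4 * k < e\<^sup>2" using n by (simp only: k_def)
      ultimately have "(dist x y)\<^sup>2 < e\<^sup>2" by argo
      thus ?thesis using \<open>e > 0\<close> by (simp add: power_less_imp_less_base)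
    qed
    thus "\<exists>n. \<forall>x\<in>R n. \<forall>y\<in>R n. dist x y < e" by blast
  qed blast
  thus ?thesis using that by (auto simp: R_def)
qed

text \<open>If the intersection were empty, the open complements would cover the space. By
  separability countably many of them suffice, and the finite partial intersections of the
  corresponding sets form a decreasing sequence with a common point.\<close>

theorem bounded_closed_convex_fip:
  fixes G :: "'i \<Rightarrow> 'a::{real_inner, complete_space, second_countable_topology} set"
  assumes closed: "\<And>i. i \<in> I \<Longrightarrow> closed (G i)" and convex: "\<And>i. i \<in> I \<Longrightarrow> convex (G i)"
    and bounded: "\<And>i. i \<in> I \<Longrightarrow> bounded (G i)"
    and fip: "\<And>J. finite J \<Longrightarrow> J \<subseteq> I \<Longrightarrow> (\<Inter>i\<in>J. G i) \<noteq> {}"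
  shows "(\<Inter>i\<in>I. G i) \<noteq> {}"
proof
  assume empty: "(\<Inter>i\<in>I. G i) = {}"
  obtain \<F> where \<F>: "\<F> \<subseteq> (\<lambda>i. - G i) ` I" "countable \<F>" "\<Union>\<F> = (\<Union>i\<in>I. - G i)"
    using Lindelof[of "(\<lambda>i. - G i) ` I"] closed by (auto simp: closed_def)
  obtain J where J: "J \<subseteq> I" "countable J" "\<F> = (\<lambda>i. - G i) ` J"
    using countable_subset_image[THEN iffD1, OF conjI, OF \<F>(2,1)] by (elim exE conjE)
  have inter: "(\<Inter>i\<in>J. G i) = {}" using empty \<F>(3) unfolding J(3) by auto
  hence "J \<noteq> {}" by auto
  \<comment> \<open>The enumeration may repeat elements, so a finite \<open>J\<close> needs no
    separate case.\<close>
  define s where "s = from_nat_into J"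
  have s: "range s = J" unfolding s_def by (rule range_from_nat_into[OF \<open>J \<noteq> {}\<close> J(2)])
  hence sI: "s n \<in> I" for n using J(1) by auto
  define S where "S n = (\<Inter>k\<le>n. G (s k))" for n
  obtain a where a: "\<And>n. a \<in> S n"
  proof (rule nested_convex_nonempty[of S])
    show "closed (S n)" "convex (S n)" for n
      unfolding S_def using sI closed convex by (auto intro!: convex_INT)
    show "S n \<noteq> {}" for n
      using fip[of "s ` {..n}"] sI unfolding S_def by auto
    show "decseq S" unfolding S_def decseq_def by fastforce
    show "bounded (S 0)" unfolding S_def using bounded[OF sI] by simp
  qed blast
  have "a \<in> G (s n)" for n using a[of n] by (auto simp: S_def)
  thus False using inter s by blast
qed

section \<open>Minty sets and the variational inequality\<close>

text \<open>Divide by \<open>m\<close> and complete the square. The ball form yields closedness,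
  convexity and boundedness together; for \<open>m = 0\<close> only a half-space or the whole space
  would remain.\<close>

lemma Minty_set_eq_cball:
  fixes v w :: "'a::real_inner"
  assumes "m > 0"
  shows "{y. m * (norm (v - y))\<^sup>2 \<le> w \<bullet> (v - y)} = cball (v - w /\<^sub>R (2 * m)) (norm w / (2 * m))"
proof (intro set_eqI)
  fix y
  have "y \<in> cball (v - w /\<^sub>R (2 * m)) (norm w / (2 * m)) \<longleftrightarrow>
      (norm ((v - y) - w /\<^sub>R (2 * m)))\<^sup>2 \<le> (norm w / (2 * m))\<^sup>2"
    using assms by (subst power_mono_iff) (auto simp: dist_norm algebra_simps)
  also have "(norm ((v - y) - w /\<^sub>R (2 * m)))\<^sup>2
      = (norm (v - y))\<^sup>2 - w \<bullet> (v - y) / m + (norm w / (2 * m))\<^sup>2"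
  proof -
    have expand: "(norm (e - c *\<^sub>R w))\<^sup>2 = (norm e)\<^sup>2 - 2 * c * (w \<bullet> e) + (c * norm w)\<^sup>2" for e c
      unfolding power_mult_distrib power2_norm_eq_inner
      by (simp add: inner_diff_left inner_diff_right inner_commute[of e w] power2_eq_square algebra_simps)
    have scale: "2 * inverse (2 * m) * a = a / m" "inverse (2 * m) * a = a / (2 * m)" for a
      using assms by (auto simp: field_simps)
    show ?thesis using expand[of "v - y" "inverse (2 * m)"] unfolding scale .
  qed
  also have "\<dots> \<le> (norm w / (2 * m))\<^sup>2 \<longleftrightarrow> m * (norm (v - y))\<^sup>2 \<le> w \<bullet> (v - y)"
    using assms by (simp add: field_simps)
  finally show "y \<in> {y. m * (norm (v - y))\<^sup>2 \<le> w \<bullet> (v - y)} \<longleftrightarrow>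
      y \<in> cball (v - w /\<^sub>R (2 * m)) (norm w / (2 * m))" by simp
qed

text \<open>To check the covering condition, suppose \<open>y\<close> in
  \<open>convex hull W\<close> lies in no Minty set of \<open>W\<close>. The contrapositive of
  pseudomonotonicity puts \<open>W\<close> into the open half-space of all \<open>v\<close> with
  \<open>F y \<bullet> v < F y \<bullet> y\<close>; by convexity it contains \<open>y\<close> too,
  which is absurd.\<close>

lemma strongly_pseudomonotone_Minty_fip:
  fixes F :: "'a::real_inner \<Rightarrow> 'a"
  assumes spm: "strongly_pseudomonotone_on C m F" and "convex C"
    and V: "finite V" "V \<noteq> {}" "V \<subseteq> C"
  shows "convex hull V \<inter> (\<Inter>v\<in>V. {y. m * (norm (v - y))\<^sup>2 \<le> F v \<bullet> (v - y)}) \<noteq> {}"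
proof (rule KKM_convex[OF V(1,2)])
  have m: "m > 0" using spm by (simp add: strongly_pseudomonotone_on_def)
  show "closed {y. m * (norm (v - y))\<^sup>2 \<le> F v \<bullet> (v - y)}" for v
    unfolding Minty_set_eq_cball[OF m] by simp
  show "convex {y. m * (norm (v - y))\<^sup>2 \<le> F v \<bullet> (v - y)}" for v
    unfolding Minty_set_eq_cball[OF m] by simp
  show "convex hull W \<subseteq> (\<Union>v\<in>W. {y. m * (norm (v - y))\<^sup>2 \<le> F v \<bullet> (v - y)})" if "W \<subseteq> V" for W
  proof (rule subsetI, rule ccontr)
    fix y
    assume y: "y \<in> convex hull W"
      and not_Minty: "y \<notin> (\<Union>v\<in>W. {y. m * (norm (v - y))\<^sup>2 \<le> F v \<bullet> (v - y)})"
    have "W \<subseteq> C" using that V(3) by blast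
    with y \<open>convex C\<close> have "y \<in> C" using hull_minimal[of W C convex] by blast
    have "W \<subseteq> {v. F y \<bullet> v < F y \<bullet> y}"
    proof
      fix v assume "v \<in> W"
      with not_Minty have "\<not> F v \<bullet> (v - y) \<ge> m * (norm (v - y))\<^sup>2" by blast
      with spm \<open>v \<in> W\<close> \<open>W \<subseteq> C\<close> \<open>y \<in> C\<close> have "F y \<bullet> (v - y) < 0"
        unfolding strongly_pseudomonotone_on_def by (meson not_le subsetD)
      thus "v \<in> {v. F y \<bullet> v < F y \<bullet> y}" by (simp add: inner_diff_right)
    qed
    hence "convex hull W \<subseteq> {v. F y \<bullet> v < F y \<bullet> y}"
      by (rule hull_minimal) (rule convex_halfspace_lt)
    with y show False by blast
  qed
qed

text \<open>Testing with \<open>z n\<close> on the segment from \<open>y\<close> to \<open>v\<close>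
  gives a factor \<open>s n > 0\<close>, which cancels; then \<open>z n\<close> tends to
  \<open>y\<close>.\<close>

lemma Minty_imp_VI:
  fixes F :: "'a::real_inner \<Rightarrow> 'a"
  assumes cont: "continuous_on C F" and "convex C" and y: "y \<in> C"
    and Minty: "\<And>v. v \<in> C \<Longrightarrow> F v \<bullet> (v - y) \<ge> 0" and v: "v \<in> C"
  shows "F y \<bullet> (v - y) \<ge> 0"
proof -
  define s where "s n = 1 / real (Suc n)" for n
  define z where "z n = y + s n *\<^sub>R (v - y)" for n
  have s: "0 < s n" "s n \<le> 1" for n by (auto simp: s_def)
  have zC: "z n \<in> C" for n
  proof -
    have "(1 - s n) *\<^sub>R y + s n *\<^sub>R v \<in> C"
      using s[of n] by (intro convexD[OF \<open>convex C\<close>] y v) auto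
    thus ?thesis by (simp add: z_def algebra_simps)
  qed
  have "z \<longlonglongrightarrow> y + 0 *\<^sub>R (v - y)"
    unfolding z_def s_def by (intro tendsto_intros lim_1_over_n[THEN LIMSEQ_Suc])
  hence "(\<lambda>n. F (z n)) \<longlonglongrightarrow> F y"
    using zC y by (intro continuous_on_tendsto_compose[OF cont]) auto
  hence "(\<lambda>n. F (z n) \<bullet> (v - y)) \<longlonglongrightarrow> F y \<bullet> (v - y)" by (intro tendsto_intros)
  moreover have "F (z n) \<bullet> (v - y) \<ge> 0" for n
    using Minty[OF zC[of n]] s[of n] by (simp add: z_def zero_le_mult_iff)
  ultimately show ?thesis by (intro LIMSEQ_le_const) auto
qed

theorem strongly_pseudomonotone_VI_ex1:
  fixes F :: "'a::{real_inner, complete_space, second_countable_topology} \<Rightarrow> 'a"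
  assumes spm: "strongly_pseudomonotone_on C m F" and cont: "continuous_on C F"
    and C: "C \<noteq> {}" "closed C" "convex C"
  shows "\<exists>!y. y \<in> C \<and> (\<forall>v\<in>C. F y \<bullet> (v - y) \<ge> 0)"
proof (rule ex_ex1I)
  have m: "m > 0" using spm by (simp add: strongly_pseudomonotone_on_def)
  have "(\<Inter>v\<in>C. C \<inter> {y. m * (norm (v - y))\<^sup>2 \<le> F v \<bullet> (v - y)}) \<noteq> {}"
  proof (rule bounded_closed_convex_fip)
    show "closed (C \<inter> {y. m * (norm (v - y))\<^sup>2 \<le> F v \<bullet> (v - y)})"
      "convex (C \<inter> {y. m * (norm (v - y))\<^sup>2 \<le> F v \<bullet> (v - y)})"
      "bounded (C \<inter> {y. m * (norm (v - y))\<^sup>2 \<le> F v \<bullet> (v - y)})" for v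
      unfolding Minty_set_eq_cball[OF m] using C by (auto intro: convex_Int)
    show "(\<Inter>v\<in>J. C \<inter> {y. m * (norm (v - y))\<^sup>2 \<le> F v \<bullet> (v - y)}) \<noteq> {}"
      if "finite J" "J \<subseteq> C" for J
    proof (cases "J = {}")
      case False
      have "convex hull J \<subseteq> C" by (rule hull_minimal) (use that C in auto)
      with strongly_pseudomonotone_Minty_fip[OF spm C(3) that(1) False that(2)] show ?thesis
        by blast
    qed simp
  qed
  \<comment> \<open>Since \<open>C\<close> is nonempty, at least one set
    \<open>C \<inter> ...\<close> takes part in the intersection, which places \<open>y\<close> in
    \<open>C\<close>.\<close>
  then obtain y where y: "y \<in> C" "\<And>v. v \<in> C \<Longrightarrow> m * (norm (v - y))\<^sup>2 \<le> F v \<bullet> (v - y)"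
    using C(1) by blast
  have "F v \<bullet> (v - y) \<ge> 0" if "v \<in> C" for v
    using y(2)[OF that] m by (smt (verit) mult_nonneg_nonneg zero_le_power2)
  thus "\<exists>y. y \<in> C \<and> (\<forall>v\<in>C. F y \<bullet> (v - y) \<ge> 0)"
    using Minty_imp_VI[OF cont C(3) y(1)] y(1) by blast
next
  fix y z
  assume y: "y \<in> C \<and> (\<forall>v\<in>C. F y \<bullet> (v - y) \<ge> 0)" and z: "z \<in> C \<and> (\<forall>v\<in>C. F z \<bullet> (v - z) \<ge> 0)"
  \<comment> \<open>The inequality solved by \<open>y\<close>, tested with \<open>z\<close>, is the
    premise of pseudomonotonicity; the one solved by \<open>z\<close>, tested with \<open>y\<close>,
    gives the opposite sign.\<close>
  have "m > 0" "m * (norm (z - y))\<^sup>2 \<le> F z \<bullet> (z - y)"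
    using spm y z by (auto simp: strongly_pseudomonotone_on_def)
  moreover have "F z \<bullet> (z - y) \<le> 0"
    using z y by (metis inner_minus_right minus_diff_eq neg_0_le_iff_le)
  ultimately have "m * (norm (z - y))\<^sup>2 \<le> 0" by linarith
  with \<open>m > 0\<close> show "y = z" by (simp add: mult_le_0_iff)
qed

section \<open>Invertibility of \<open>P\<close> and the return to the original problem\<close>

text \<open>For \<open>r > 0\<close> the solutions of \<open>P x = y\<close> are the fixed points of
  the map taking \<open>x\<close> to \<open>x - r *\<^sub>R (P x - y)\<close>, a contraction for
  suitable \<open>r\<close>.\<close>

theorem coercive_bij:
  fixes P :: "'a::{real_inner, complete_space} \<Rightarrow> 'a"
  assumes "bounded_linear P" "coercive P"
  shows "bij P"
proof -
  interpret P: bounded_linear P by fact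
  obtain c where c: "c > 0" "\<And>x. P x \<bullet> x \<ge> c * (norm x)\<^sup>2"
    using assms(2) by (auto simp: coercive_def)
  obtain M where M: "M > 0" "\<And>x. norm (P x) \<le> norm x * M"
    using P.pos_bounded by blast
  define r where "r = c / M\<^sup>2"
  have "r > 0" using c M by (simp add: r_def)
  \<comment> \<open>In the zero space \<open>c\<close> may exceed \<open>M\<close>; the maximum with
    0 keeps \<open>sqrt q\<close> nonnegative there.\<close>
  define q where "q = max 0 (1 - c\<^sup>2 / M\<^sup>2)"
  have q: "0 \<le> q" "q < 1" using c M by (auto simp: q_def)
  \<comment> \<open>\<open>r\<close> minimises the bound \<open>1 - 2 * r * c + r\<^sup>2 * M\<^sup>2\<close> for the squared contraction factor.\<close>
  have contr: "norm (x - r *\<^sub>R P x) \<le> sqrt q * norm x" for x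
  proof -
    have "(norm (x - r *\<^sub>R P x))\<^sup>2 = (norm x)\<^sup>2 - 2 * r * (P x \<bullet> x) + r\<^sup>2 * (norm (P x))\<^sup>2"
      unfolding power2_norm_eq_inner
      by (simp add: inner_diff inner_commute power2_eq_square algebra_simps)
    also have "\<dots> \<le> (norm x)\<^sup>2 - 2 * r * (c * (norm x)\<^sup>2) + r\<^sup>2 * (norm x * M)\<^sup>2"
      using c(2)[of x] M(2)[of x] \<open>r > 0\<close>
      by (intro add_mono diff_left_mono mult_left_mono power_mono) auto
    also have "\<dots> = (1 - c\<^sup>2 / M\<^sup>2) * (norm x)\<^sup>2"
      using M(1) by (simp add: r_def field_simps power2_eq_square)
    also have "\<dots> \<le> q * (norm x)\<^sup>2" by (intro mult_right_mono) (auto simp: q_def)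
    finally have "norm (x - r *\<^sub>R P x) \<le> sqrt (q * (norm x)\<^sup>2)" by (rule real_le_rsqrt)
    thus ?thesis by (simp add: real_sqrt_mult)
  qed
  have "\<exists>!x. P x = y" for y
  proof -
    have "\<exists>!x. x - r *\<^sub>R (P x - y) = x"
    proof (rule banach_fix_type)
      show "0 \<le> sqrt q" "sqrt q < 1" using q by auto
      have diff: "x - r *\<^sub>R (P x - y) - (x' - r *\<^sub>R (P x' - y)) = (x - x') - r *\<^sub>R P (x - x')" for x x'
        by (simp add: P.diff algebra_simps)
      thus "\<forall>x x'. dist (x - r *\<^sub>R (P x - y)) (x' - r *\<^sub>R (P x' - y)) \<le> sqrt q * dist x x'"
        unfolding dist_norm diff using contr by blast
    qed
    thus ?thesis using \<open>r > 0\<close> by simp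
  qed
  thus ?thesis by (simp add: bij_iff)
qed

theorem proposition3p2:
  fixes T :: real
    and S :: "real \<Rightarrow> 'h::{real_inner, banach, second_countable_topology} \<Rightarrow>\<^sub>L 'h"
    and D :: "'h set" and A :: "'h \<Rightarrow> 'h"
    and P :: "'h \<Rightarrow> 'h"
    and K :: "real \<Rightarrow> 'h set"
    and f h :: "real \<Rightarrow> 'h \<Rightarrow> 'h \<Rightarrow> 'h"
    and \<gamma> L\<^sub>F :: real
  assumes T_pos: "T > 0"
    and semigroup: "C0_semigroup S"
    and generator: "infinitesimal_generator S D A"
    and P_bounded_linear: "bounded_linear P"
    and P_self_adjoint: "self_adjoint P"
    and P_coercive: "coercive P"
    and K_values: "\<forall>t\<in>{0..T}. K t \<noteq> {} \<and> closed (K t) \<and> convex (K t)"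
    and f_caratheodory: "caratheodory T (\<lambda>t (y, z). f t y z)"
    and h_caratheodory: "caratheodory T (\<lambda>t (y, z). h t y z)"
    and f_L1: "integrable (lebesgue_on {0..T}) (\<lambda>t. f t 0 0)"
    and gamma_pos: "\<gamma> > 0" and L_F_pos: "L\<^sub>F > 0"
    and F_strongly_pseudomonotone:
      "\<forall>t\<in>{0..T}. \<forall>x. strongly_pseudomonotone_on (K t) \<gamma> (F_op P h t x)"
    and F_lipschitz: "\<forall>t\<in>{0..T}. \<forall>x. L\<^sub>F-lipschitz_on UNIV (F_op P h t x)"
  shows "\<forall>t\<in>{0..T}. \<forall>x. \<exists>!u. P u \<in> K t \<and> (\<forall>v\<in>K t. (h t x u - u) \<bullet> (v - P u) \<le> 0)"
proof (intro ballI allI)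
  fix t x assume t: "t \<in> {0..T}"
  have P: "bij P" by (rule coercive_bij[OF P_bounded_linear P_coercive])
  have F: "F_op P h t x (P u) = - (h t x u - u)" for u
    using P by (simp add: F_op_def bij_is_inj)
  have "continuous_on (K t) (F_op P h t x)"
    using F_lipschitz t by (meson continuous_on_subset lipschitz_on_continuous_on subset_UNIV)
  hence "\<exists>!y. y \<in> K t \<and> (\<forall>v\<in>K t. F_op P h t x y \<bullet> (v - y) \<ge> 0)"
    using F_strongly_pseudomonotone K_values t by (intro strongly_pseudomonotone_VI_ex1) auto
  then obtain y where y: "y \<in> K t" "\<forall>v\<in>K t. F_op P h t x y \<bullet> (v - y) \<ge> 0"
    and unique: "\<And>z. z \<in> K t \<Longrightarrow> \<forall>v\<in>K t. F_op P h t x z \<bullet> (v - z) \<ge> 0 \<Longrightarrow> z = y"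
    by blast
  have VI: "(h t x u - u) \<bullet> (v - P u) \<le> 0 \<longleftrightarrow> F_op P h t x (P u) \<bullet> (v - P u) \<ge> 0" for u v
    unfolding F inner_minus_left by simp
  \<comment> \<open>Surjectivity of \<open>P\<close> gives existence of \<open>u\<close>;
    injectivity carries the uniqueness of \<open>y\<close> over to \<open>u\<close>.\<close>
  obtain u where u: "y = P u" using P by (meson bij_pointE)
  show "\<exists>!u. P u \<in> K t \<and> (\<forall>v\<in>K t. (h t x u - u) \<bullet> (v - P u) \<le> 0)"
    unfolding VI
  proof (rule ex1I[of _ u])
    show "P u \<in> K t \<and> (\<forall>v\<in>K t. F_op P h t x (P u) \<bullet> (v - P u) \<ge> 0)" using y u by simp
    show "u' = u" if "P u' \<in> K t \<and> (\<forall>v\<in>K t. F_op P h t x (P u') \<bullet> (v - P u') \<ge> 0)" for u'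
      using unique[of "P u'"] that u bij_is_inj[OF P] by (simp add: inj_eq)
  qed
qed

end
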